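(* Let $g\ge4$ be even and let $m$ be an odd integer relatively prime to $g$. Suppose that (i) every proper divisor $d$ of $m$ is complete, and (ii) $o_g(m)>\min_{n}\Big\{2^n\Big\lceil \frac{m}{(g-1)g^n}\Big\rceil\Big\}$, the minimum taken over natural numbers $n$. Then $m$ is complete. If only condition (ii) holds, then $m$ is not primitive.
   Context: For an odd integer $m\ge1$, an extreme cycle for the digit set $\{0,m\}$ (with respect to the even integer $g\ge4$) is a finite set of distinct integers $\{x_0,\dots,x_{r-1}\}$ together with digits $l_0,\dots,l_{r-1}\in\{0,m\}$ such that $x_{j+1}=(x_j+l_j)/g$ for $0\le j\le r-2$ and $x_0=(x_{r-1}+l_{r-1})/g$. The cycle $\{0\}$ is the trivial extreme cycle. $m$ is complete if the only extreme cycle for $\{0,m\}$ is the trivial one, and incomplete otherwise. An odd number $m$ is primitive if it is incomplete and every proper divisor of $m$ is complete. $o_g(m)$ denotes the order of $g$ in $U(\mathbb{Z}_m)$; $\lceil x\rceil$ is the smallest integer $\ge x$. *)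

theory Defs
  imports Complex_Main "HOL-Number_Theory.Number_Theory"
begin

text \<open>
  A cycle \<open>x\<^sub>0, \<dots>, x\<^sub>r\<^sub>-\<^sub>1\<close> with its digits \<open>l\<^sub>0, \<dots>, l\<^sub>r\<^sub>-\<^sub>1\<close> is given by the two lists
  \<open>xs\<close> and \<open>ls\<close>. The division by \<open>g\<close> is the exact one in the reals,
  not integer division.
\<close>

definition extreme_cycle :: "nat \<Rightarrow> nat \<Rightarrow> int list \<Rightarrow> int list \<Rightarrow> bool" where
  "extreme_cycle g m xs ls \<longleftrightarrow>
     xs \<noteq> [] \<and> length ls = length xs \<and> distinct xs \<and> set ls \<subseteq> {0, int m} \<and>
     (\<forall>j. j + 1 < length xs \<longrightarrow> real_of_int (xs ! (j + 1)) = real_of_int (xs ! j + ls ! j) / real g) \<and>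
     real_of_int (xs ! 0) = real_of_int (xs ! (length xs - 1) + ls ! (length xs - 1)) / real g"

text \<open>Over the point \<open>0\<close> the digit is forced to be \<open>0\<close>, so the trivial cycle is determined by its
  set of points \<open>{0}\<close>.\<close>

definition complete_num :: "nat \<Rightarrow> nat \<Rightarrow> bool" where
  "complete_num g m \<longleftrightarrow> (\<forall>xs ls. extreme_cycle g m xs ls \<longrightarrow> set xs = {0})"

abbreviation incomplete_num :: "nat \<Rightarrow> nat \<Rightarrow> bool" where
  "incomplete_num g m \<equiv> \<not> complete_num g m"

definition primitive_num :: "nat \<Rightarrow> nat \<Rightarrow> bool" where
  "primitive_num g m \<longleftrightarrow>
     odd m \<and> incomplete_num g m \<and> (\<forall>d. d dvd m \<and> d \<noteq> m \<longrightarrow> complete_num g d)"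

end

theory Submission
  imports Defs
begin

text \<open>
  Let \<open>r\<close> be the length of a nontrivial cycle. If a point shared a factor \<open>d > 1\<close> with \<open>m\<close>, then
  so would all of them, and division by \<open>d\<close> would give a nontrivial cycle for the proper divisor
  \<open>m / d\<close>. Otherwise going once around the cycle gives \<open>g\<^sup>r = 1\<close> modulo \<open>m\<close>, so the order of \<open>g\<close> is
  at most \<open>r\<close>. On the other hand the points lie in \<open>(0, m / (g - 1)]\<close>; going back \<open>n\<close> steps from a
  point, one sees that they lie in \<open>2\<^sup>n\<close> half-open intervals of length \<open>m / ((g - 1) g\<^sup>n)\<close>, each of
  which contains at most \<open>\<lceil>m / ((g - 1) g\<^sup>n)\<rceil>\<close> integers.
\<close>

section \<open>Cycles as recursions over the integers\<close>

lemma extreme_cycle_iff: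
  assumes "g > 0"
  shows "extreme_cycle g m xs ls \<longleftrightarrow>
     xs \<noteq> [] \<and> length ls = length xs \<and> distinct xs \<and> set ls \<subseteq> {0, int m} \<and>
     (\<forall>j. Suc j < length xs \<longrightarrow> int g * xs ! Suc j = xs ! j + ls ! j) \<and>
     int g * xs ! 0 = xs ! (length xs - 1) + ls ! (length xs - 1)"
proof -
  have "real_of_int a = real_of_int b / real g \<longleftrightarrow> int g * a = b" for a b
  proof -
    have "real_of_int a = real_of_int b / real g \<longleftrightarrow> real_of_int (int g * a) = real_of_int b"
      using assms by (simp add: field_simps)
    then show ?thesis
      by (simp only: of_int_eq_iff)
  qed
  then show ?thesis
    unfolding extreme_cycle_def by (simp only: Suc_eq_plus1)
qed

text \<open>The recursion is homogeneous in the points, the digits and the modulus, so a common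
  factor cancels. This produces cycles for divisors.\<close>

lemma extreme_cycle_unscale:
  assumes "g > 0" "d > 0"
    and "extreme_cycle g (d * m) (map ((*) (int d)) xs) (map ((*) (int d)) ls)"
  shows "extreme_cycle g m xs ls"
proof -
  have "int g * (int d * a) = int d * b + int d * c \<longleftrightarrow> int g * a = b + c" for a b c
  proof -
    have "int g * (int d * a) = int d * b + int d * c \<longleftrightarrow> int d * (int g * a) = int d * (b + c)"
      by (simp add: algebra_simps)
    then show ?thesis
      using assms(2) by simp
  qed
  then show ?thesis
    using assms by (auto simp: extreme_cycle_iff distinct_map)
qed

text \<open>Hides the wrap-around at index 0: later arguments only walk backwards and need no
  indices.\<close>

lemma extreme_cycle_pred:
  assumes "g > 0" "extreme_cycle g m xs ls" "y \<in> set xs"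
  shows "\<exists>x\<in>set xs. \<exists>l\<in>{0, int m}. int g * y = x + l"
proof -
  obtain j where j: "j < length xs" "y = xs ! j"
    using assms(3) by (auto simp: in_set_conv_nth)
  have "\<exists>i < length xs. int g * y = xs ! i + ls ! i"
  proof (cases j)
    case 0
    then show ?thesis
      using assms(1,2) j by (intro exI[of _ "length xs - 1"]) (auto simp: extreme_cycle_iff)
  next
    case (Suc i)
    then show ?thesis
      using assms(1,2) j by (intro exI[of _ i]) (auto simp: extreme_cycle_iff)
  qed
  then obtain i where "i < length xs" "int g * y = xs ! i + ls ! i"
    by blast
  moreover from this have "ls ! i \<in> {0, int m}"
    using assms(1,2) nth_mem[of i ls] by (auto simp: extreme_cycle_iff simp del: nth_mem)
  ultimately show ?thesis
    by (metis nth_mem)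
qed

text \<open>Extremal argument: the predecessor of the least point \<open>a\<close> is at least
  \<open>a\<close>, so \<open>g * a >= a\<close>. The predecessor of the greatest point
  \<open>b\<close> is at most \<open>b\<close>, so \<open>g * b <= b + m\<close>.\<close>

lemma extreme_cycle_bounds:
  assumes "g > 1" "extreme_cycle g m xs ls" "y \<in> set xs"
  shows "0 \<le> y" "(int g - 1) * y \<le> int m"
proof -
  have fin: "finite (set xs)" and ne: "set xs \<noteq> {}"
    using assms(3) by auto
  define a where "a = Min (set xs)"
  define b where "b = Max (set xs)"
  obtain x l where x: "x \<in> set xs" "l \<in> {0, int m}" "int g * a = x + l"
    using extreme_cycle_pred[of g m xs ls a] assms Min_in[OF fin ne] unfolding a_def by force
  have "a \<le> x"
    using x fin by (simp add: a_def)
  with x have "0 \<le> (int g - 1) * a"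
    by (auto simp: algebra_simps)
  with assms(1) have "0 \<le> a"
    by (simp add: zero_le_mult_iff)
  also have "a \<le> y"
    using assms fin by (simp add: a_def)
  finally show "0 \<le> y" .
  obtain x l where x: "x \<in> set xs" "l \<in> {0, int m}" "int g * b = x + l"
    using extreme_cycle_pred[of g m xs ls b] assms Max_in[OF fin ne] unfolding b_def by force
  have "x \<le> b"
    using x fin by (simp add: b_def)
  with x have "(int g - 1) * b \<le> int m"
    by (auto simp: algebra_simps)
  moreover have "(int g - 1) * y \<le> (int g - 1) * b"
    using assms fin by (intro mult_left_mono) (auto simp: b_def)
  ultimately show "(int g - 1) * y \<le> int m"
    by simp
qed

section \<open>Divisibility along a cycle\<close>

lemma extreme_cycle_dvd:
  assumes "g > 0" "extreme_cycle g m xs ls" "j < length xs"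
  shows "int m dvd int g ^ j * xs ! j - xs ! 0"
  using assms(3)
proof (induction j)
  case 0
  then show ?case by simp
next
  case (Suc j)
  have "ls ! j \<in> {0, int m}"
    using assms(1,2) Suc.prems nth_mem[of j ls]
    by (auto simp: extreme_cycle_iff simp del: nth_mem)
  then have "int m dvd int g ^ j * ls ! j"
    by auto
  moreover have "int g * xs ! Suc j = xs ! j + ls ! j"
    using assms(1,2) Suc.prems by (auto simp: extreme_cycle_iff)
  \<comment> \<open>The weight \<open>g ^ j\<close> makes the recursion telescope; what remains are
    digits, all multiples of \<open>m\<close>.\<close>
  then have "int g ^ j * (int g * xs ! Suc j) = int g ^ j * (xs ! j + ls ! j)"
    by simp
  then have "int g ^ Suc j * xs ! Suc j - xs ! 0
      = (int g ^ j * xs ! j - xs ! 0) + int g ^ j * ls ! j"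
    by (simp add: algebra_simps)
  ultimately show ?case
    using Suc by (simp only: dvd_add Suc_lessD)
qed

text \<open>The same telescoping with one more step, the one that closes the cycle.\<close>

lemma extreme_cycle_dvd_closed:
  assumes "g > 0" "extreme_cycle g m xs ls"
  shows "int m dvd int g ^ length xs * xs ! 0 - xs ! 0"
proof -
  define j where "j = length xs - 1"
  have j: "length xs = Suc j"
    using assms by (auto simp: extreme_cycle_iff j_def)
  have "ls ! j \<in> {0, int m}"
    using assms j nth_mem[of j ls] by (auto simp: extreme_cycle_iff simp del: nth_mem)
  then have "int m dvd int g ^ j * ls ! j"
    by auto
  moreover have "int g * xs ! 0 = xs ! j + ls ! j"
    using assms by (auto simp: extreme_cycle_iff j_def)
  then have "int g ^ j * (int g * xs ! 0) = int g ^ j * (xs ! j + ls ! j)"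
    by simp
  then have "int g ^ length xs * xs ! 0 - xs ! 0
      = (int g ^ j * xs ! j - xs ! 0) + int g ^ j * ls ! j"
    by (simp add: j algebra_simps)
  ultimately show ?thesis
    using extreme_cycle_dvd[OF assms, of j] j by (simp only: dvd_add lessI)
qed

text \<open>Being a divisor of \<open>m\<close>, \<open>d\<close> is coprime to \<open>g\<close>, so
  powers of \<open>g\<close> cancel modulo \<open>d\<close>. Divisibility passes from
  \<open>x\<close> to \<open>xs ! 0\<close> and from there to \<open>y\<close>.\<close>

lemma extreme_cycle_common_dvd:
  assumes "g > 0" "extreme_cycle g m xs ls" "coprime m g"
    and "d dvd int m" "x \<in> set xs" "d dvd x" "y \<in> set xs"
  shows "d dvd y"
proof -
  have cop: "coprime d (int g ^ j)" for j
    using assms(3,4) by (metis coprime_divisors coprime_int_iff coprime_power_right_iff dvd_refl)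
  have "d dvd int g ^ j * xs ! j - xs ! 0" if "j < length xs" for j
    using extreme_cycle_dvd[OF assms(1,2) that] assms(4) by (rule dvd_trans[rotated])
  moreover obtain i where "i < length xs" "x = xs ! i"
    using assms(5) by (auto simp: in_set_conv_nth)
  ultimately have "d dvd xs ! 0"
    using assms(6) by (metis dvd_diff_right_iff dvd_mult)
  moreover obtain j where j: "j < length xs" "y = xs ! j"
    using assms(7) by (auto simp: in_set_conv_nth)
  ultimately have "d dvd int g ^ j * xs ! j"
    using \<open>\<And>j. j < length xs \<Longrightarrow> d dvd int g ^ j * xs ! j - xs ! 0\<close>
    by (metis dvd_diff_left_iff)
  with cop j show ?thesis
    by (simp add: coprime_dvd_mult_right_iff)
qed

text \<open>If 0 is a point, then \<open>m\<close> divides every point; but a positive point is at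
  most \<open>m / (g - 1)\<close>, which is less than \<open>m\<close>.\<close>

lemma extreme_cycle_nonzero:
  assumes "g > 2" "m > 0" "extreme_cycle g m xs ls" "coprime m g" "set xs \<noteq> {0}"
  shows "0 \<notin> set xs"
proof
  assume 0: "0 \<in> set xs"
  have "y = 0" if y: "y \<in> set xs" for y
  proof (rule ccontr)
    assume "y \<noteq> 0"
    have "int m dvd y"
      using extreme_cycle_common_dvd[of g m xs ls "int m" 0 y] assms 0 y by simp
    moreover have bounds: "0 \<le> y" "(int g - 1) * y \<le> int m"
      using extreme_cycle_bounds[of g m xs ls y] assms y by auto
    ultimately have "int m \<le> y"
      using \<open>y \<noteq> 0\<close> by (simp add: zdvd_imp_le)
    moreover have "2 * y \<le> (int g - 1) * y"
      using assms(1) bounds by (intro mult_right_mono) auto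
    ultimately show False
      using bounds assms(2) by simp
  qed
  with 0 assms(5) show False
    by blast
qed

section \<open>Counting the points of a cycle\<close>

text \<open>The numbers with \<open>n\<close> base-\<open>g\<close> digits from
  \<open>{0, m}\<close>. The new digit enters at the lowest place because one more step back
  multiplies the earlier sum by \<open>g\<close>.\<close>

fun digit_sums :: "nat \<Rightarrow> nat \<Rightarrow> nat \<Rightarrow> int set" where
  "digit_sums g m 0 = {0}"
| "digit_sums g m (Suc n) = (\<Union>l\<in>{0, int m}. (\<lambda>s. l + int g * s) ` digit_sums g m n)"

lemma finite_digit_sums: "finite (digit_sums g m n)"
  by (induction n) auto

lemma card_digit_sums_le: "card (digit_sums g m n) \<le> 2 ^ n"
proof (induction n)
  case (Suc n)
  have "card (digit_sums g m (Suc n))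
      \<le> card ((\<lambda>s. int g * s) ` digit_sums g m n) + card ((\<lambda>s. int m + int g * s) ` digit_sums g m n)"
    by (simp add: card_Un_le)
  also have "\<dots> \<le> 2 ^ n + 2 ^ n"
    by (intro add_mono order_trans[OF card_image_le Suc]) (simp_all add: finite_digit_sums)
  finally show ?case
    by simp
qed simp

lemma extreme_cycle_iterated_pred:
  assumes "g > 0" "extreme_cycle g m xs ls" "y \<in> set xs"
  shows "\<exists>x\<in>set xs. \<exists>s\<in>digit_sums g m n. int g ^ n * y = x + s"
proof (induction n)
  case 0
  then show ?case
    using assms(3) by simp
next
  case (Suc n)
  then obtain x s where x: "x \<in> set xs" "s \<in> digit_sums g m n" "int g ^ n * y = x + s"
    by blast
  obtain x' l where x': "x' \<in> set xs" "l \<in> {0, int m}" "int g * x = x' + l"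
    using extreme_cycle_pred[OF assms(1,2) x(1)] by blast
  have "int g ^ Suc n * y = int g * (int g ^ n * y)"
    by simp
  also have "\<dots> = x' + (l + int g * s)"
    by (simp only: x(3) distrib_left x'(3) add.assoc)
  finally have "int g ^ Suc n * y = x' + (l + int g * s)" .
  moreover have "l + int g * s \<in> digit_sums g m (Suc n)"
    using x x' by auto
  ultimately show ?case
    using x'(1) by blast
qed

text \<open>Half-openness matters when \<open>L\<close> is an integer: a closed interval could then
  contain \<open>L + 1\<close> integers.\<close>

lemma card_half_open_interval_int:
  fixes a L :: real
  shows "finite {y::int. a < of_int y \<and> of_int y \<le> a + L}"
    and "card {y::int. a < of_int y \<and> of_int y \<le> a + L} \<le> nat \<lceil>L\<rceil>"
proof -
  have eq: "{y::int. a < of_int y \<and> of_int y \<le> a + L} = {\<lfloor>a\<rfloor> + 1..\<lfloor>a + L\<rfloor>}"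
    by (auto simp: le_floor_iff floor_less_iff add1_zle_eq)
  show "finite {y::int. a < of_int y \<and> of_int y \<le> a + L}"
    by (simp add: eq)
  have "\<lfloor>a + L\<rfloor> - \<lfloor>a\<rfloor> \<le> \<lceil>L\<rceil>"
    by linarith
  then show "card {y::int. a < of_int y \<and> of_int y \<le> a + L} \<le> nat \<lceil>L\<rceil>"
    by (simp add: eq)
qed

lemma length_extreme_cycle_le:
  assumes "g > 2" "m > 0" "extreme_cycle g m xs ls" "coprime m g" "set xs \<noteq> {0}"
  shows "length xs \<le> 2 ^ n * nat \<lceil>real m / ((real g - 1) * real g ^ n)\<rceil>"
proof -
  define L where "L = real m / ((real g - 1) * real g ^ n)"
  define I where "I s = {y::int. real_of_int s / real g ^ n < of_int y \<and>
    of_int y \<le> real_of_int s / real g ^ n + L}" for s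
  have gn: "real g ^ n > 0"
    using assms(1) by simp
  have "set xs \<subseteq> (\<Union>s\<in>digit_sums g m n. I s)"
  proof
    fix y assume "y \<in> set xs"
    then obtain x s where x: "x \<in> set xs" "s \<in> digit_sums g m n" "int g ^ n * y = x + s"
      using extreme_cycle_iterated_pred[of g m xs ls y n] assms by auto
    have "0 \<le> x" "(int g - 1) * x \<le> int m"
      using extreme_cycle_bounds[of g m xs ls x] assms x by auto
    \<comment> \<open>This excludes the left endpoint \<open>s / g ^ n\<close> of the interval for
      \<open>y = (x + s) / g ^ n\<close>.\<close>
    moreover have "x \<noteq> 0"
      using extreme_cycle_nonzero[OF assms] x by auto
    ultimately have "real_of_int x > 0" and "real_of_int ((int g - 1) * x) \<le> real_of_int (int m)"
      by (simp_all only: of_int_le_iff of_int_0_less_iff)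
    then have pos: "real_of_int x > 0" and le: "real_of_int x \<le> real m / (real g - 1)"
      using assms(1) by (simp_all add: field_simps)
    have "real_of_int (int g ^ n * y) = real_of_int (x + s)"
      by (simp only: x(3))
    then have "real_of_int y = real_of_int s / real g ^ n + real_of_int x / real g ^ n"
      using gn by (simp add: field_simps)
    moreover have "real_of_int x / real g ^ n \<le> L"
      using divide_right_mono[OF le, of "real g ^ n"] gn by (simp add: L_def)
    moreover have "real_of_int x / real g ^ n > 0"
      using pos gn by simp
    ultimately show "y \<in> (\<Union>s\<in>digit_sums g m n. I s)"
      using x(2) by (intro UN_I[of s]) (auto simp: I_def)
  qed
  moreover have "finite (\<Union>s\<in>digit_sums g m n. I s)"
    unfolding I_def using card_half_open_interval_int(1) finite_digit_sums by blast
  ultimately have "card (set xs) \<le> card (\<Union>s\<in>digit_sums g m n. I s)"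
    by (rule card_mono[rotated])
  also have "\<dots> \<le> (\<Sum>s\<in>digit_sums g m n. card (I s))"
    by (rule card_UN_le[OF finite_digit_sums])
  also have "\<dots> \<le> (\<Sum>s\<in>digit_sums g m n. nat \<lceil>L\<rceil>)"
    unfolding I_def by (intro sum_mono card_half_open_interval_int(2))
  also have "\<dots> \<le> 2 ^ n * nat \<lceil>L\<rceil>"
    using card_digit_sums_le by simp
  finally show ?thesis
    using assms(3) by (simp add: L_def extreme_cycle_def distinct_card)
qed

section \<open>The order of \<open>g\<close> and coprimality to \<open>m\<close>\<close>

lemma ord_le_length_extreme_cycle:
  assumes "g > 0" "extreme_cycle g m xs ls" "coprime (xs ! 0) (int m)"
  shows "ord m g \<le> length xs"
proof -
  have "int m dvd (int g ^ length xs - 1) * xs ! 0"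
    using extreme_cycle_dvd_closed[OF assms(1,2)] by (simp add: algebra_simps)
  then have "int m dvd int g ^ length xs - 1"
    using assms(3) by (simp add: coprime_commute coprime_dvd_mult_left_iff)
  then have "[int (g ^ length xs) = int 1] (mod int m)"
    by (simp add: cong_iff_dvd_diff)
  then have "ord m g dvd length xs"
    unfolding cong_int_iff ord_divides .
  \<comment> \<open>A cycle is nonempty, so its length is positive and a divisor of it cannot exceed
    it.\<close>
  then show ?thesis
    using assms(2) by (auto simp: extreme_cycle_def intro!: dvd_imp_le)
qed

lemma extreme_cycle_coprime:
  assumes "g > 0" "m > 0" "extreme_cycle g m xs ls" "coprime m g" "set xs \<noteq> {0}"
    and "\<And>d. d dvd m \<Longrightarrow> d \<noteq> m \<Longrightarrow> complete_num g d" "x \<in> set xs"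
  shows "coprime x (int m)"
proof (rule ccontr)
  assume ncop: "\<not> coprime x (int m)"
  define d where "d = nat (gcd x (int m))"
  have d: "int d = gcd x (int m)"
    by (simp add: d_def)
  with assms(2) ncop have "d > 0" "d \<noteq> 1"
    by (auto simp: d_def coprime_iff_gcd_eq_1)
  have "int d dvd int m"
    by (simp add: d)
  then obtain k where k: "m = d * k"
    by (auto simp: int_dvd_int_iff)
  define ys where "ys = map (\<lambda>y. y div int d) xs"
  define ks where "ks = map (\<lambda>y. y div int d) ls"
  \<comment> \<open>The factor shared by \<open>x\<close> and \<open>m\<close> spreads to all
    points, so the divisions by \<open>d\<close> in \<open>ys\<close> are exact.\<close>
  have "int d dvd y" if "y \<in> set xs" for y
    using extreme_cycle_common_dvd[OF assms(1,3,4) _ assms(7) _ that, of "int d"] by (simp add: d)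
  then have xs: "xs = map ((*) (int d)) ys"
    by (simp add: ys_def map_idI)
  have "int d dvd y" if "y \<in> set ls" for y
    using that assms(3) \<open>int d dvd int m\<close> by (auto simp: extreme_cycle_def)
  then have ls: "ls = map ((*) (int d)) ks"
    by (simp add: ks_def map_idI)
  have "extreme_cycle g k ys ks"
    using extreme_cycle_unscale[of g d k ys ks] assms(1,3) \<open>d > 0\<close> by (simp add: k flip: xs ls)
  \<comment> \<open>Since \<open>d\<close> is not 1 and \<open>m\<close> is positive,
    \<open>k\<close> is a proper divisor of \<open>m\<close>.\<close>
  moreover have "complete_num g k"
    using assms(2,6) k \<open>d \<noteq> 1\<close> by simp
  ultimately have "set ys = {0}"
    by (auto simp: complete_num_def)
  then have "set xs = {0}"
    by (subst xs) simp
  with assms(5) show False ..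
qed

theorem theorem2p30:
  fixes g m :: nat
  assumes "g \<ge> 4" and "even g" and "odd m" and "coprime m g"
    and "ord m g > (LEAST k. \<exists>n::nat. k = 2 ^ n * nat \<lceil>real m / ((real g - 1) * real g ^ n)\<rceil>)"
  shows "((\<forall>d. d dvd m \<and> d \<noteq> m \<longrightarrow> complete_num g d) \<longrightarrow> complete_num g m) \<and>
         \<not> primitive_num g m"
proof -
  \<comment> \<open>This gives both claims: a primitive \<open>m\<close> would be incomplete
    although its proper divisors are complete.\<close>
  have "complete_num g m" if compl: "\<forall>d. d dvd m \<and> d \<noteq> m \<longrightarrow> complete_num g d"
  proof (rule ccontr)
    assume "\<not> complete_num g m"
    then obtain xs ls where cyc: "extreme_cycle g m xs ls" "set xs \<noteq> {0}"
      by (auto simp: complete_num_def)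
    have pos: "g > 0" "g > 2" "m > 0"
      using assms(1,3) by (auto intro: odd_pos)
    \<comment> \<open>The minimum is attained at some \<open>n\<close>; the bound on the length
      holds for every \<open>n\<close>, hence for this one.\<close>
    obtain n where "(LEAST k. \<exists>n::nat. k = 2 ^ n * nat \<lceil>real m / ((real g - 1) * real g ^ n)\<rceil>)
        = 2 ^ n * nat \<lceil>real m / ((real g - 1) * real g ^ n)\<rceil>"
      using LeastI_ex[of "\<lambda>k. \<exists>n::nat. k = 2 ^ n * nat \<lceil>real m / ((real g - 1) * real g ^ n)\<rceil>"]
      by blast
    with assms(5) have "length xs < ord m g"
      using length_extreme_cycle_le[OF pos(2,3) cyc(1) assms(4) cyc(2), of n] by simp
    moreover have "xs ! 0 \<in> set xs"
      using cyc(1) by (simp add: extreme_cycle_def)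
    then have "coprime (xs ! 0) (int m)"
      using extreme_cycle_coprime[OF pos(1,3) cyc(1) assms(4) cyc(2)] compl by blast
    ultimately show False
      using ord_le_length_extreme_cycle[OF pos(1) cyc(1)] by simp
  qed
  then show ?thesis
    by (auto simp: primitive_num_def)
qed

end
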